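(* Given a pilot length $N_{LoP}$, the optimal linear detectors for the $M$ users, i.e. the solution of $$\mathbf{L}^\star(N_{LoP})=\arg\min_{\mathbf{L}=\{\mathbf{L}_1,\dots,\mathbf{L}_M\}}\ \sum_{m=1}^{M}\mathcal{E}_m(N_{LoP},\mathbf{L}_m),$$ are $\mathbf{L}^\star=\{\mathbf{L}_1^\star,\dots,\mathbf{L}_M^\star\}$ with $$\mathbf{L}_m^\star=\mathbf{d}_m^{H}\mathbf{G}^{-1},\qquad m=1,\dots,M,$$ where $\mathbf{d}_m$, $\mathbf{G}$ and the expected decoding error probability $\mathcal{E}_m$ are defined in the context.
   Context: A base station with $N_T$ antennas serves $M$ single-antenna users, $N_T\gg M$, with common transmit power $\rho>0$. The blocklength is $N_{CU}=N_{LoP}+R_{CU}$ channel uses, with $N_{LoP}\in\{M,\dots,N_{CU}-1\}$ used for pilots and $R_{CU}$ for data. For user $m$, $\lambda_m$ (path loss) and $\beta_m$ (lognormal shadow fading) are positive quantities treated as constant and known, and $r_m$ is a given target data rate. Channel estimates: the small-scale channel of user $m$ is $\mathbf{h}'_m\sim\mathcal{CN}(0,\mathbf{I}_{N_T})$ (Rayleigh fading). The users send mutually orthogonal pilots $\mathbf{s}^{(p)}_m\in\mathbb{C}^{N_{LoP}\times1}$, $(\mathbf{s}^{(p)}_m)^H\mathbf{s}^{(p)}_m=1$ and $(\mathbf{s}^{(p)}_m)^H\mathbf{s}^{(p)}_n=0$ for $m\ne n$, and the least-squares estimate $\hat{\mathbf{h}}'_m$ satisfies $\hat{\mathbf{h}}'_m-\mathbf{h}'_m=\frac{1}{N_{LoP}\sqrt{\rho\lambda_m\beta_m}}\mathbf{N}^{(p)}\big[(\mathbf{s}^{(p)}_m)^T\big]^H$,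 where $\mathbf{N}^{(p)}\in\mathbb{C}^{N_T\times N_{LoP}}$ has i.i.d. $\mathcal{CN}(0,1)$ entries. Put $$\delta_m=\frac{\rho N_{LoP}\lambda_m\beta_m}{\rho N_{LoP}\lambda_m\beta_m+1},\quad \mathbf{d}_m=\delta_m\sqrt{\lambda_m\beta_m}\,\hat{\mathbf{h}}'_m,\quad \omega=\Big(\sum_{i=1}^M\frac{\lambda_i\beta_i}{\rho N_{LoP}\lambda_i\beta_i+1}+\frac1\rho\Big)^{-1},$$ $\mathbf{D}=[\mathbf{d}_1,\dots,\mathbf{d}_M]$ and $\mathbf{G}=\mathbf{D}\mathbf{D}^H+\frac1\omega\mathbf{I}_{N_T}$. A linear detector for user $m$ is a nonzero $\mathbf{L}_m\in\mathbb{C}^{1\times N_T}$ applied to the received data signal at the base station (which uses the channel estimates as the true channel). The resulting SINR is $$\hat\gamma_m(N_{LoP},\mathbf{L}_m)=\frac{\mathbf{L}_m\mathbf{d}_m\mathbf{d}_m^H\mathbf{L}_m^H}{\mathbf{L}_m(\mathbf{G}-\mathbf{d}_m\mathbf{d}_m^H)\mathbf{L}_m^H}.$$ With $C(\gamma)=\log_2(1+\gamma)$, $\mathcal{V}(\gamma)=(1-(1+\gamma)^{-2})(\log_2 e)^2$ and $Q(x)=\int_x^\infty\frac1{\sqrt{2\pi}}e^{-t^2/2}\,dt$, the decoding error probability of user $m$ is $$\hat\epsilon_m(N_{LoP},\mathbf{L}_m)=Q\left(\sqrt{\frac{R_{CU}\big(C(\hat\gamma_m)-r_m\big)^2}{\mathcal{V}(\hat\gamma_m)}}\right),\qquad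 \hat\gamma_m=\hat\gamma_m(N_{LoP},\mathbf{L}_m),$$ and its expectation over the SINR is $$\mathcal{E}_m(N_{LoP},\mathbf{L}_m)=\mathbb{E}_{\hat\gamma_m}[\hat\epsilon_m(N_{LoP},\mathbf{L}_m)]=\int_0^\infty\hat\epsilon_m\,p_{\hat\gamma_m(N_{LoP},\mathbf{L}_m)}(x)\,dx,$$ where in the integrand $\hat\epsilon_m$ is evaluated at SINR value $x$ and $p_{\hat\gamma_m(N_{LoP},\mathbf{L}_m)}$ is the probability density of $\hat\gamma_m(N_{LoP},\mathbf{L}_m)$. This density is approximated by the Gamma density $x^{\mu_m-1}e^{-x/\nu_m}/(\Gamma(\mu_m)\nu_m^{\mu_m})$, where, with $\hat\lambda_m=\lambda_m\beta_m\delta_m$ and $T_i=N_T\omega\hat\lambda_i\big(1-\frac{M-1}{N_T}+\frac{M-1}{N_T}\psi_m\big)+1$, $$\mu_m=\frac{(N_T-M+1+(M-1)\psi_m)^2}{N_T-M+1+(M-1)\kappa_m},\quad \nu_m=\frac{N_T-M+1+(M-1)\kappa_m}{N_T-M+1+(M-1)\psi_m}\,\omega\hat\lambda_m,$$ and $\psi_m,\kappa_m$ are determined by $\psi_m=\frac1{M-1}\sum_{i\ne m}\frac1{T_i}$ and $\kappa_m\big(1+\sum_{i\ne m}\frac{\omega\hat\lambda_i}{T_i^2}\big)=\sum_{i\ne m}\frac{\omega\hat\lambda_i\psi_m+\frac1{M-1}}{T_i^2}$.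
   Formalization: The argument of Q is taken as the signed sqrt(R_CU/V)(C−r_m), not sqrt(R_CU(C−r_m)²/V): with the latter and r_m>0, detectors nearly orthogonal to d_m have error tending to 0, so the claim fails; both agree when C≥r_m. *)

theory Defs
  imports "HOL-Probability.Probability"
begin

text \<open>Column vectors are \<open>complex^1^'n\<close> and row vectors \<open>complex^'n^1\<close>. The channel estimates of
  all users form the matrix \<open>H :: complex^'m^'n\<close> whose column \<open>m\<close> is the estimate for user \<open>m\<close>.\<close>

definition ctranspose :: "complex^'n^'m \<Rightarrow> complex^'m^'n" where
  "ctranspose A = (\<chi> i j. cnj (A $ j $ i))"

definition (in prob_space) std_complex_normal :: "('a \<Rightarrow> complex) \<Rightarrow> bool" where
  "std_complex_normal Z \<longleftrightarrow> distributed M lborel Z (\<lambda>z. ennreal (exp (- (cmod z)\<^sup>2) / pi))"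

definition delta :: "real \<Rightarrow> nat \<Rightarrow> ('m \<Rightarrow> real) \<Rightarrow> ('m \<Rightarrow> real) \<Rightarrow> 'm \<Rightarrow> real" where
  "delta \<rho> N lam bet m = \<rho> * real N * lam m * bet m / (\<rho> * real N * lam m * bet m + 1)"

definition omega :: "real \<Rightarrow> nat \<Rightarrow> ('m::finite \<Rightarrow> real) \<Rightarrow> ('m \<Rightarrow> real) \<Rightarrow> real" where
  "omega \<rho> N lam bet =
     inverse ((\<Sum>i\<in>UNIV. lam i * bet i / (\<rho> * real N * lam i * bet i + 1)) + 1 / \<rho>)"

definition dvec ::
  "real \<Rightarrow> nat \<Rightarrow> ('m::finite \<Rightarrow> real) \<Rightarrow> ('m \<Rightarrow> real) \<Rightarrow> complex^'m^'n \<Rightarrow> 'm \<Rightarrow> complex^1^'n" where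
  "dvec \<rho> N lam bet H m =
     (delta \<rho> N lam bet m * sqrt (lam m * bet m)) *\<^sub>R columnvector (column m H)"

definition Dmat ::
  "real \<Rightarrow> nat \<Rightarrow> ('m::finite \<Rightarrow> real) \<Rightarrow> ('m \<Rightarrow> real) \<Rightarrow> complex^'m^'n \<Rightarrow> complex^'m^'n" where
  "Dmat \<rho> N lam bet H = (\<chi> k m. dvec \<rho> N lam bet H m $ k $ 1)"

definition Gmat ::
  "real \<Rightarrow> nat \<Rightarrow> ('m::finite \<Rightarrow> real) \<Rightarrow> ('m \<Rightarrow> real) \<Rightarrow> complex^'m^'n \<Rightarrow> complex^'n^'n" where
  "Gmat \<rho> N lam bet H =
     Dmat \<rho> N lam bet H ** ctranspose (Dmat \<rho> N lam bet H)
       + (1 / omega \<rho> N lam bet) *\<^sub>R mat 1"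

text \<open>Numerator and denominator are Hermitian \<open>1 \<times> 1\<close> matrices, so taking real parts loses nothing.\<close>

definition sinr :: "complex^1^'n \<Rightarrow> complex^'n^'n \<Rightarrow> complex^'n^1 \<Rightarrow> real" where
  "sinr d G L =
     Re ((L ** d ** ctranspose d ** ctranspose L) $ 1 $ 1)
       / Re ((L ** (G - d ** ctranspose d) ** ctranspose L) $ 1 $ 1)"

definition capacity :: "real \<Rightarrow> real" where
  "capacity \<gamma> = log 2 (1 + \<gamma>)"

definition dispersion :: "real \<Rightarrow> real" where
  "dispersion \<gamma> = (1 - 1 / (1 + \<gamma>)\<^sup>2) * (log 2 (exp 1))\<^sup>2"

text \<open>The tail function takes extended real arguments, so that \<open>Qfun (-\<infinity>) = 1\<close> and \<open>Qfun \<infinity> = 0\<close>.\<close>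

definition Qfun :: "ereal \<Rightarrow> real" where
  "Qfun x = (LBINT t=x..\<infinity>. 1 / sqrt (2 * pi) * exp (- t\<^sup>2 / 2))"

text \<open>The argument of \<open>Qfun\<close>, often written
  \<open>sqrt (R * (capacity \<gamma> - r)\<^sup>2 / dispersion \<gamma>)\<close>, is the signed quantity
  \<open>sqrt (R / dispersion \<gamma>) * (capacity \<gamma> - r)\<close> of the normal approximation: the two agree for
  \<open>r \<le> capacity \<gamma>\<close> (lemma \<open>err_prob_eq\<close>), and for \<open>capacity \<gamma> < r\<close> the error probability is at
  least \<open>1/2\<close>. Taking the absolute value there instead would let the error probability tend to
  \<open>0\<close> as \<open>\<gamma>\<close> tends to \<open>0\<close>. The quotient is formed in \<open>ereal\<close>, where
  division by \<open>0\<close> is multiplication by \<open>\<infinity>\<close>; at \<open>\<gamma> = 0\<close> (zero dispersion) this yields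
  \<open>Qfun (-\<infinity>)\<close> for \<open>r > 0\<close>, the limit of the error probability from the right.\<close>

definition err_prob :: "nat \<Rightarrow> real \<Rightarrow> real \<Rightarrow> real" where
  "err_prob R r \<gamma> =
     Qfun (ereal (sqrt (real R) * (capacity \<gamma> - r)) / ereal (sqrt (dispersion \<gamma>)))"

lemma dispersion_pos: "0 < \<gamma> \<Longrightarrow> 0 < dispersion \<gamma>"
  by (simp add: dispersion_def field_simps power2_eq_square add_pos_pos)

lemma err_prob_eq:
  assumes "0 < \<gamma>" "r \<le> capacity \<gamma>"
  shows "err_prob R r \<gamma> = Qfun (ereal (sqrt (real R * (capacity \<gamma> - r)\<^sup>2 / dispersion \<gamma>)))"
  using dispersion_pos[OF assms(1)] assms(2)
  by (simp add: err_prob_def real_sqrt_divide real_sqrt_mult)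

lemma err_prob_zero:
  assumes "0 < R" "0 < r"
  shows "err_prob R r 0 = Qfun (-\<infinity>)"
proof -
  have "\<not> sqrt (real R) * r < 0" using assms by (simp add: not_less)
  then show ?thesis
    using assms by (simp add: err_prob_def dispersion_def capacity_def divide_ereal_def)
qed

text \<open>A detector may depend on the channel estimates, hence is a function \<open>L\<close> of \<open>H\<close>. The expectation
  is taken with respect to the law of the SINR; when the SINR has a density it is the integral
  against that density (lemma \<open>expected_err_density\<close>).\<close>

definition sinr_rv ::
  "real \<Rightarrow> nat \<Rightarrow> ('m::finite \<Rightarrow> real) \<Rightarrow> ('m \<Rightarrow> real) \<Rightarrow> ('w \<Rightarrow> complex^'m^'n) \<Rightarrow> 'm
    \<Rightarrow> (complex^'m^'n \<Rightarrow> complex^'n^1) \<Rightarrow> 'w \<Rightarrow> real" where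
  "sinr_rv \<rho> N lam bet H m L w =
     sinr (dvec \<rho> N lam bet (H w) m) (Gmat \<rho> N lam bet (H w)) (L (H w))"

definition expected_err :: "'w measure \<Rightarrow> nat \<Rightarrow> real \<Rightarrow> ('w \<Rightarrow> real) \<Rightarrow> real" where
  "expected_err P R r \<gamma> = (\<integral>x. err_prob R r x \<partial>distr P borel \<gamma>)"

lemma Qfun_measurable [measurable]: "Qfun \<in> borel_measurable borel"
proof -
  have "Qfun = (\<lambda>x. \<integral>t. indicator {z \<in> space (borel \<Otimes>\<^sub>M lborel). fst z < ereal (snd z)} (x, t)
      * (1 / sqrt (2 * pi) * exp (- t\<^sup>2 / 2)) \<partial>lborel)"
    by (auto simp: Qfun_def interval_lebesgue_integral_def set_lebesgue_integral_def einterval_def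
        space_pair_measure indicator_def intro!: ext Bochner_Integration.integral_cong)
  moreover have "(\<lambda>x. \<integral>t. indicator {z \<in> space (borel \<Otimes>\<^sub>M lborel). fst z < ereal (snd z)} (x, t)
      * (1 / sqrt (2 * pi) * exp (- t\<^sup>2 / 2)) \<partial>lborel) \<in> borel_measurable (borel :: ereal measure)"
    by measurable
  ultimately show ?thesis by metis
qed

lemma err_prob_measurable [measurable]: "err_prob R r \<in> borel_measurable borel"
  unfolding err_prob_def capacity_def dispersion_def by measurable

lemma expected_err_density:
  assumes "distributed P lborel \<gamma> (\<lambda>x. ennreal (p x))" "\<And>x. 0 \<le> p x" "\<And>x. x < 0 \<Longrightarrow> p x = 0"
  shows "expected_err P R r \<gamma> = (LBINT x=0..\<infinity>. err_prob R r x * p x)"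
proof -
  have m: "\<gamma> \<in> measurable P borel"
    using distributed_measurable[OF assms(1)] by simp
  have "expected_err P R r \<gamma> = (\<integral>w. err_prob R r (\<gamma> w) \<partial>P)"
    unfolding expected_err_def using m by (intro integral_distr) auto
  also have "\<dots> = (\<integral>x. p x * err_prob R r x \<partial>lborel)"
    using distributed_integral[OF assms(1), of "err_prob R r"] assms(2) by simp
  also have "\<dots> = (\<integral>x. indicator (einterval 0 \<infinity>) x *\<^sub>R (err_prob R r x * p x) \<partial>lborel)"
  proof (rule integral_cong_AE)
    have [measurable]: "p \<in> borel_measurable lborel"
      using distributed_real_measurable[OF _ assms(1)] assms(2) by simp
    show "(\<lambda>x. p x * err_prob R r x) \<in> borel_measurable lborel" by measurable
    show "(\<lambda>x. indicator (einterval 0 \<infinity>) x *\<^sub>R (err_prob R r x * p x)) \<in> borel_measurable lborel"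
      by measurable
    have "AE x in lborel. x \<noteq> (0::real)" by (rule AE_lborel_singleton)
    then show "AE x in lborel. p x * err_prob R r x
        = indicator (einterval 0 \<infinity>) x *\<^sub>R (err_prob R r x * p x)"
      by eventually_elim (auto simp: einterval_def indicator_def zero_ereal_def assms(3))
  qed
  also have "\<dots> = (LBINT x=0..\<infinity>. err_prob R r x * p x)"
    by (simp add: interval_lebesgue_integral_def set_lebesgue_integral_def)
  finally show ?thesis .
qed

text \<open>The formula of the optimal detector vanishes where the estimate of user \<open>m\<close> does, which is a
  null event; therefore nonzero is required almost surely.\<close>

definition linear_detectors ::
  "'w measure \<Rightarrow> ('w \<Rightarrow> complex^'m^'n) \<Rightarrow> ('m \<Rightarrow> complex^'m^'n \<Rightarrow> complex^'n^1) \<Rightarrow> bool" where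
  "linear_detectors P H L \<longleftrightarrow>
     (\<forall>m. L m \<in> borel_measurable borel \<and> (AE w in P. L m (H w) \<noteq> 0))"

end

theory Submission
  imports Defs
begin

text \<open>For every realisation of the channel estimates the detector \<open>K = d\<^sub>m\<^sup>H G\<^sup>-\<^sup>1\<close> maximises the SINR:
  by Cauchy--Schwarz in the inner product of \<open>G\<close>, \<open>\<bar>L d\<^sub>m\<bar>\<^sup>2 \<le> (L G L\<^sup>H) (K G K\<^sup>H)\<close>, where
  \<open>L d\<^sub>m = L G K\<^sup>H\<close> and \<open>K d\<^sub>m = K G K\<^sup>H\<close> because \<open>K G = d\<^sub>m\<^sup>H\<close>. Since the error
  probability is decreasing in the SINR, the expected error probability of each user is
  minimised separately. The detector is nonzero almost surely because each entry of the channel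
  estimate is the sum of a Gaussian and an independent noise term.\<close>

section \<open>Monotonicity of the error probability in the SINR\<close>

text \<open>The library facts on \<open>std_normal_density\<close> (nonnegativity, integrability,
  total mass 1) become available for the monotonicity and the bounds of \<open>Qfun\<close>.\<close>

lemma Qfun_eq_std_normal:
  "Qfun x = (\<integral>t\<in>einterval x \<infinity>. std_normal_density t \<partial>lborel)"
  by (simp add: Qfun_def interval_lebesgue_integral_def std_normal_density_def)

lemma set_integrable_std_normal:
  "A \<in> sets borel \<Longrightarrow> set_integrable lborel A std_normal_density"
  unfolding set_integrable_def
  by (rule integrable_mult_indicator) auto

lemma Qfun_antimono: "x \<le> y \<Longrightarrow> Qfun y \<le> Qfun x"
  unfolding Qfun_eq_std_normal set_lebesgue_integral_def
  using set_integrable_std_normal[unfolded set_integrable_def]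
  by (intro integral_mono) (auto simp: einterval_def split: split_indicator intro: order.strict_trans1)

lemma Qfun_nonneg: "0 \<le> Qfun x"
  unfolding Qfun_eq_std_normal set_lebesgue_integral_def
  by (intro integral_nonneg_AE) auto

lemma Qfun_le_1: "Qfun x \<le> 1"
proof -
  have "Qfun x \<le> (\<integral>t. std_normal_density t \<partial>lborel)"
    unfolding Qfun_eq_std_normal set_lebesgue_integral_def
    using set_integrable_std_normal[unfolded set_integrable_def]
    by (intro integral_mono) (auto split: split_indicator)
  then show ?thesis by simp
qed

text \<open>The derivative has the sign of x^2 - 1 - ln x, which is nonnegative because ln x \<le> x
  - 1 \<le> x^2 - 1 for x > 1. With u = 1 + \<gamma> the function is the capacity divided by the
  root of the dispersion.\<close>

lemma ln_div_sqrt_mono: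
  fixes u v :: real
  assumes "1 < u" "u \<le> v"
  shows "ln u / sqrt (1 - 1 / u\<^sup>2) \<le> ln v / sqrt (1 - 1 / v\<^sup>2)"
proof (rule DERIV_nonneg_imp_nondecreasing[OF assms(2)])
  fix x :: real assume "u \<le> x" "x \<le> v"
  then have x: "1 < x" using assms by simp
  define V where "V = 1 - 1 / x\<^sup>2"
  have V: "0 < V" unfolding V_def using x by (simp add: field_simps)
  have l: "ln x \<le> x\<^sup>2 - 1"
  proof -
    have "ln x \<le> x - 1" using ln_le_minus_one[of x] x by simp
    also have "x \<le> x\<^sup>2" using x by (simp add: power2_eq_square)
    finally show ?thesis by simp
  qed
  have d: "((\<lambda>x. ln x / sqrt (1 - 1 / x\<^sup>2)) has_real_derivative
      (1 / x * sqrt V - ln x * ((2 / x ^ 3) / (2 * sqrt V))) / V) (at x)"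
    using x V unfolding V_def
    by (auto intro!: derivative_eq_intros simp: field_simps power2_eq_square power3_eq_cube)
  have "1 / x * sqrt V - ln x * ((2 / x ^ 3) / (2 * sqrt V)) = (x\<^sup>2 - 1 - ln x) / (x ^ 3 * sqrt V)"
  proof -
    have "V = (x\<^sup>2 - 1) / x\<^sup>2" using x by (simp add: V_def field_simps)
    moreover have "1 / x * sqrt V = V / (x * sqrt V)" using V x by (simp add: field_simps)
    ultimately have "1 / x * sqrt V = (x\<^sup>2 - 1) / x\<^sup>2 / (x * sqrt V)" by metis
    then show ?thesis using x V by (simp add: field_simps power2_eq_square power3_eq_cube)
  qed
  also have "\<dots> \<ge> 0" using l x V by simp
  finally show "\<exists>y. ((\<lambda>x. ln x / sqrt (1 - 1 / x\<^sup>2)) has_real_derivative y) (at x) \<and> 0 \<le> y"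
    using d V by (meson divide_nonneg_pos)
qed

lemma sqrt_dispersion:
  "sqrt (dispersion x) = sqrt (1 - 1 / (1 + x)\<^sup>2) / ln 2"
  by (simp add: dispersion_def real_sqrt_mult log_def real_sqrt_divide)

text \<open>For positive SINR the argument of \<open>Qfun\<close> is sqrt R times the difference of
  C / sqrt V, which is nondecreasing, and r / sqrt V, which is nonincreasing because r \<ge> 0 and V
  grows. SINR 0 has zero dispersion and is compared in \<open>ereal\<close>.\<close>

lemma err_prob_antimono:
  assumes "0 \<le> x" "x \<le> y" "0 \<le> r"
  shows "err_prob R r y \<le> err_prob R r x"
proof (cases "x = y")
  case False
  then have y: "0 < y" using assms by simp
  note Vy = dispersion_pos[OF y]
  have quot: "ereal a / ereal (sqrt (dispersion z)) = ereal (a / sqrt (dispersion z))" if "0 < z" for a z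
    using dispersion_pos[OF that] by simp
  have "ereal (sqrt (real R) * (capacity x - r)) / ereal (sqrt (dispersion x))
      \<le> ereal (sqrt (real R) * (capacity y - r)) / ereal (sqrt (dispersion y))"
  proof (cases "x = 0")
    case True
    \<comment> \<open>At \<open>x = 0\<close> capacity and dispersion vanish. If
      \<open>R = 0\<close> or \<open>r = 0\<close>, the quotient is 0 / 0, which is 0 in
      \<open>ereal\<close>, and the argument at \<open>y\<close> is nonnegative. Otherwise a
      negative number is divided by 0, giving -\<infinity>.\<close>
    show ?thesis
    proof (cases "R = 0 \<or> r = 0")
      case True
      have "0 \<le> capacity y" using y by (simp add: capacity_def)
      then have "0 \<le> sqrt (real R) * (capacity y - r)" using True by auto
      moreover have "sqrt (real R) * (capacity 0 - r) = 0" using True by (auto simp: capacity_def)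
      moreover have "ereal 0 / e = 0" for e :: ereal by (simp add: zero_ereal_def[symmetric])
      ultimately show ?thesis unfolding quot[OF y] \<open>x = 0\<close>
        using divide_nonneg_pos[OF _ real_sqrt_gt_zero[OF Vy]] by (simp only: ereal_less_eq)
    next
      case False
      then have "sqrt (real R) * r > 0" using assms by simp
      then have "ereal (sqrt (real R) * (capacity x - r)) / ereal (sqrt (dispersion x)) = - \<infinity>"
        using \<open>x = 0\<close> by (auto simp: dispersion_def capacity_def divide_ereal_def not_less zero_less_mult_iff)
      then show ?thesis by simp
    qed
  next
    case False
    then have x: "0 < x" using assms by simp
    \<comment> \<open>The factor 1 / ln 2 from the base-2 logarithm occurs in both the capacity and
      the root of the dispersion, so it cancels in their quotient.\<close>
    have eq: "(capacity z - r) / sqrt (dispersion z) =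
       ln (1 + z) / sqrt (1 - 1 / (1 + z)\<^sup>2) - r / sqrt (dispersion z)" for z
    proof -
      have "capacity z / sqrt (dispersion z) = ln (1 + z) / sqrt (1 - 1 / (1 + z)\<^sup>2)"
        unfolding sqrt_dispersion by (simp add: capacity_def log_def)
      then show ?thesis by (simp add: diff_divide_distrib)
    qed
    have "1 - 1 / (1 + x)\<^sup>2 \<le> 1 - 1 / (1 + y)\<^sup>2"
      using assms x by (simp add: frac_le power_mono)
    then have "dispersion x \<le> dispersion y"
      unfolding dispersion_def by (intro mult_right_mono) auto
    then have "r / sqrt (dispersion y) \<le> r / sqrt (dispersion x)"
      using assms dispersion_pos[OF x] by (intro divide_left_mono) (auto intro!: mult_pos_pos y dispersion_pos)
    moreover have "ln (1 + x) / sqrt (1 - 1 / (1 + x)\<^sup>2) \<le> ln (1 + y) / sqrt (1 - 1 / (1 + y)\<^sup>2)"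
      using x assms by (intro ln_div_sqrt_mono) auto
    ultimately have "(capacity x - r) / sqrt (dispersion x) \<le> (capacity y - r) / sqrt (dispersion y)"
      unfolding eq by linarith
    then have "sqrt (real R) * ((capacity x - r) / sqrt (dispersion x))
        \<le> sqrt (real R) * ((capacity y - r) / sqrt (dispersion y))"
      by (intro mult_left_mono) auto
    then show ?thesis unfolding quot[OF x] quot[OF y] by simp
  qed
  then show ?thesis unfolding err_prob_def by (rule Qfun_antimono)
qed simp

lemma err_prob_bounds: "0 \<le> err_prob R r x" "err_prob R r x \<le> 1"
  unfolding err_prob_def by (rule Qfun_nonneg, rule Qfun_le_1)

text \<open>Error probabilities lie in [0,1], so measurability of the SINR alone makes them
  integrable. After pulling the integral back from the law of the SINR to the sample space, the
  comparison is pointwise.\<close>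

lemma (in prob_space) expected_err_antimono:
  assumes [measurable]: "f \<in> borel_measurable M" "g \<in> borel_measurable M"
    and "0 \<le> r" "\<And>w. w \<in> space M \<Longrightarrow> 0 \<le> f w" "\<And>w. w \<in> space M \<Longrightarrow> f w \<le> g w"
  shows "expected_err M R r g \<le> expected_err M R r f"
proof -
  have i: "integrable M (\<lambda>w. err_prob R r (f w))" if [measurable]: "f \<in> borel_measurable M" for f
    by (rule integrable_const_bound[where B=1])
      (auto simp: abs_of_nonneg err_prob_bounds)
  show ?thesis unfolding expected_err_def
    using assms i by (simp add: integral_distr) (intro integral_mono err_prob_antimono, auto)
qed

section \<open>Conjugate transposes and Hermitian forms of row vectors\<close>

lemma ctranspose_ctranspose [simp]: "ctranspose (ctranspose A) = A"
  by (simp add: ctranspose_def vec_eq_iff)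

lemma ctranspose_matrix_mul: "ctranspose (A ** B) = ctranspose B ** ctranspose A"
  by (simp add: ctranspose_def matrix_matrix_mult_def vec_eq_iff mult.commute)

lemma ctranspose_add: "ctranspose (A + B) = ctranspose A + ctranspose B"
  by (simp add: ctranspose_def vec_eq_iff)

lemma ctranspose_diff: "ctranspose (A - B) = ctranspose A - ctranspose B"
  by (simp add: ctranspose_def vec_eq_iff)

lemma ctranspose_scaleR: "ctranspose (c *\<^sub>R A) = c *\<^sub>R ctranspose A"
  by (simp add: ctranspose_def vec_eq_iff)

lemma ctranspose_mat: "ctranspose (mat c) = mat (cnj c)"
  by (simp add: ctranspose_def mat_def vec_eq_iff)

lemma ctranspose_eq_0_iff [simp]: "ctranspose A = 0 \<longleftrightarrow> A = 0"
  by (auto simp: ctranspose_def vec_eq_iff)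

lemma matrix_mul_1_1: "(A ** B) $ 1 $ 1 = A $ 1 $ 1 * B $ 1 $ 1" for A B :: "complex^1^1"
  by (simp add: matrix_matrix_mult_def)

text \<open>The product regroups as the 1 x 1 matrix \<open>L ** d\<close> times its own conjugate
  transpose.\<close>

lemma rank_one_form: "(L ** d ** ctranspose d ** ctranspose L) $ 1 $ 1 = of_real ((cmod ((L ** d) $ 1 $ 1))\<^sup>2)"
  for L :: "complex^'n^1" and d :: "complex^1^'n"
proof -
  have "L ** d ** ctranspose d ** ctranspose L = (L ** d) ** ctranspose (L ** d)"
    by (simp add: ctranspose_matrix_mul matrix_mul_assoc)
  then show ?thesis
    by (simp add: matrix_mul_1_1 ctranspose_def complex_norm_square del: of_real_power)
qed

lemma matrix_diff_ldistrib: "A ** (B - C) = A ** B - A ** C" for A :: "complex^'n^'m"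
  by (simp add: matrix_matrix_mult_def vec_eq_iff right_diff_distrib sum_subtractf)

lemma matrix_diff_rdistrib: "(A - B) ** C = A ** C - B ** C" for A :: "complex^'n^'m"
  by (simp add: matrix_matrix_mult_def vec_eq_iff left_diff_distrib sum_subtractf)

lemma matrix_add_rdistrib: "(A + B) ** C = A ** C + B ** C" for A :: "complex^'n^'m"
  by (simp add: matrix_matrix_mult_def vec_eq_iff distrib_right sum.distrib)

lemma matrix_sum_sandwich:
  fixes L :: "complex^'n^'m"
  shows "L ** (\<Sum>i\<in>S. f i) ** R = (\<Sum>i\<in>S. L ** f i ** R)"
  by (induction S rule: infinite_finite_induct)
    (simp_all add: matrix_add_ldistrib matrix_add_rdistrib)

text \<open>Sesquilinear expansion for the Cauchy--Schwarz argument. Scalars enter as 1 x 1 matrices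
  \<open>mat s\<close>, so that scaling a row is a matrix product. \<open>G\<close> is arbitrary
  here, hence the two cross terms stay separate.\<close>

lemma form_diff_expand:
  fixes L K :: "complex^'n^1" and s a :: complex
  defines "X \<equiv> mat s ** L - mat a ** K"
  shows "(X ** G ** ctranspose X) $ 1 $ 1 =
    s * cnj s * (L ** G ** ctranspose L) $ 1 $ 1 - s * cnj a * (L ** G ** ctranspose K) $ 1 $ 1
    - a * cnj s * (K ** G ** ctranspose L) $ 1 $ 1 + a * cnj a * (K ** G ** ctranspose K) $ 1 $ 1"
proof -
  have X: "ctranspose X = ctranspose L ** mat (cnj s) - ctranspose K ** mat (cnj a)"
    by (simp add: X_def ctranspose_diff ctranspose_matrix_mul ctranspose_mat)
  have m: "(mat c ** U ** G ** (ctranspose V ** mat e)) $ 1 $ 1 = c * e * (U ** G ** ctranspose V) $ 1 $ 1"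
    for c e and U V :: "complex^'n^1"
  proof -
    have "mat c ** U ** G ** (ctranspose V ** mat e) = mat c ** (U ** G ** ctranspose V) ** mat e"
      by (simp add: matrix_mul_assoc)
    then show ?thesis by (simp add: matrix_mul_1_1 mat_def)
  qed
  show ?thesis
    unfolding X unfolding X_def
    by (simp add: matrix_diff_ldistrib matrix_diff_rdistrib m)
qed

section \<open>Maximisation of the SINR for a fixed channel estimate\<close>

text \<open>The SINR depends on \<open>L\<close> only through the two numbers |L d|^2 and L G L^H,
  exactly those that Cauchy--Schwarz compares.\<close>

lemma sinr_eq:
  "sinr d G L = (cmod ((L ** d) $ 1 $ 1))\<^sup>2
     / (Re ((L ** G ** ctranspose L) $ 1 $ 1) - (cmod ((L ** d) $ 1 $ 1))\<^sup>2)"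
  by (simp add: sinr_def rank_one_form matrix_diff_ldistrib matrix_diff_rdistrib matrix_mul_assoc)

text \<open>Positivity is assumed of the interference part G - d d^H: it makes the denominators
  positive and, after adding |L d|^2, makes the form of \<open>G\<close> positive definite. The
  maximiser is described by \<open>K ** G = ctranspose d\<close>, so no inverse occurs in the
  argument.\<close>

lemma sinr_le:
  fixes d :: "complex^1^'n" and L K :: "complex^'n^1"
  assumes herm: "ctranspose G = G"
    and pd: "\<And>L :: complex^'n^1. L \<noteq> 0 \<Longrightarrow> 0 < Re ((L ** (G - d ** ctranspose d) ** ctranspose L) $ 1 $ 1)"
    and K: "K ** G = ctranspose d"
  shows "sinr d G L \<le> sinr d G K"
proof -
  define F where "F L = Re ((L ** G ** ctranspose L) $ 1 $ 1)" for L :: "complex^'n^1"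
  define a where "a = (L ** d) $ 1 $ 1"
  define s where "s = (K ** d) $ 1 $ 1"
  have pos: "(cmod ((L ** d) $ 1 $ 1))\<^sup>2 < F L" if "L \<noteq> 0" for L
    using pd[OF that]
    by (simp add: F_def rank_one_form matrix_diff_ldistrib matrix_diff_rdistrib matrix_mul_assoc)
  have nonneg: "(cmod ((L ** d) $ 1 $ 1))\<^sup>2 \<le> F L" for L
    using pos[of L] by (cases "L = 0") (auto simp: F_def)
  have d: "G ** ctranspose K = d"
    using arg_cong[OF K, of ctranspose] by (simp add: ctranspose_matrix_mul herm)
  have LK: "(L ** G ** ctranspose K) $ 1 $ 1 = a"
    by (simp add: a_def d flip: matrix_mul_assoc)
  have KK: "(K ** G ** ctranspose K) $ 1 $ 1 = s"
    by (simp add: s_def d flip: matrix_mul_assoc)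
  have cnj: "(K ** G ** ctranspose U) $ 1 $ 1 = cnj ((U ** d) $ 1 $ 1)" for U :: "complex^'n^1"
    unfolding K by (simp add: ctranspose_def matrix_matrix_mult_def mult.commute)
  have KL: "(K ** G ** ctranspose L) $ 1 $ 1 = cnj a"
    by (simp add: cnj a_def)
  \<comment> \<open>K G K^H equals both K d and its conjugate, so K d is real and coincides with
    \<open>F K\<close>.\<close>
  have "s = cnj s" using cnj[of K] KK by (simp add: s_def)
  then have s: "s = of_real (F K)"
    using KK by (simp add: F_def complex_eq_iff)
  have s0: "0 \<le> F K" using nonneg[of K] by (rule order_trans[rotated]) simp
  \<comment> \<open>This is \<open>s\<close> times the component of \<open>L\<close> orthogonal to
    \<open>K\<close> in the inner product of \<open>G\<close>. Multiplying through by
    \<open>s\<close> avoids a division, so \<open>s = 0\<close> needs no separate case here.\<close>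
  define X where "X = mat s ** L - mat a ** K"
  have cmod: "cmod a * cmod a = Re a * Re a + Im a * Im a"
    using cmod_power2[of a] by (simp add: power2_eq_square)
  have "0 \<le> F X" using nonneg[of X] by (rule order_trans[rotated]) simp
  also have "F X = (F K)\<^sup>2 * F L - F K * (cmod a)\<^sup>2"
    unfolding F_def X_def form_diff_expand LK KK KL unfolding F_def[symmetric] s
    by (simp add: F_def[symmetric] cmod power2_eq_square algebra_simps)
  also have "\<dots> = F K * (F K * F L - (cmod a)\<^sup>2)"
    by (simp add: power2_eq_square algebra_simps)
  finally have cs: "0 \<le> F K * (F K * F L - (cmod a)\<^sup>2)" .
  have sK: "sinr d G K = (F K)\<^sup>2 / (F K - (F K)\<^sup>2)"
    by (simp add: sinr_eq s_def[symmetric] F_def[symmetric]) (simp add: s)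
  have sL: "sinr d G L = (cmod a)\<^sup>2 / (F L - (cmod a)\<^sup>2)"
    by (simp add: sinr_eq a_def[symmetric] F_def[symmetric])
  show ?thesis
  \<comment> \<open>In the degenerate case \<open>a = 0\<close> (\<open>K = 0\<close> forces
    \<open>d = 0\<close>), so the left SINR is 0 and the right one is nonnegative. Otherwise,
    clearing the positive denominators reduces the claim to |a|^2 \<le> F K * F L.\<close>
  proof (cases "L = 0 \<or> K = 0")
    case True
    have "a = 0"
    proof (cases "K = 0")
      case True
      then have "d = 0" using K by (metis ctranspose_eq_0_iff times0_left)
      then show ?thesis by (simp add: a_def matrix_matrix_mult_def)
    next
      case False
      then show ?thesis using True by (simp add: a_def matrix_matrix_mult_def)
    qed
    moreover have "(F K)\<^sup>2 \<le> F K" using nonneg[of K] by (simp add: s_def[symmetric] s)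
    ultimately show ?thesis unfolding sK sL by simp
  next
    case False
    have L: "0 < F L - (cmod a)\<^sup>2" using pos[of L] False by (simp add: a_def)
    have lt: "(F K)\<^sup>2 < F K" using pos[of K] False by (simp add: s_def[symmetric] s)
    then have FK: "0 < F K" by (rule le_less_trans[rotated]) simp
    have "(cmod a)\<^sup>2 \<le> F K * F L"
      using cs FK by (simp add: zero_le_mult_iff)
    moreover have "0 < F K - (F K)\<^sup>2" using lt by simp
    ultimately show ?thesis
      unfolding sK sL using L FK
      by (simp add: divide_le_eq le_divide_eq) (simp add: power2_eq_square algebra_simps)
  qed
qed

text \<open>Places the SINR in the range where the error probability is known to be monotone. For
  \<open>L = 0\<close> the value is 0 / 0 = 0.\<close>

lemma sinr_nonneg:
  fixes d :: "complex^1^'n" and L :: "complex^'n^1"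
  assumes "\<And>L :: complex^'n^1. L \<noteq> 0 \<Longrightarrow> 0 < Re ((L ** (G - d ** ctranspose d) ** ctranspose L) $ 1 $ 1)"
  shows "0 \<le> sinr d G L"
  using assms[of L] unfolding sinr_def rank_one_form by (cases "L = 0") simp_all

section \<open>Positivity and invertibility of the matrix G\<close>

text \<open>D D^H is a sum of rank-one terms, one per user, so subtracting the term of user
  \<open>m\<close> just removes a summand.\<close>

lemma Gmat_eq:
  "Gmat \<rho> N lam bet X = (\<Sum>i\<in>UNIV. dvec \<rho> N lam bet X i ** ctranspose (dvec \<rho> N lam bet X i))
     + (1 / omega \<rho> N lam bet) *\<^sub>R mat 1"
  by (simp add: Gmat_def Dmat_def ctranspose_def matrix_matrix_mult_def vec_eq_iff)

lemma ctranspose_Gmat: "ctranspose (Gmat \<rho> N lam bet X) = Gmat \<rho> N lam bet X"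
  by (simp add: Gmat_def ctranspose_add ctranspose_matrix_mul ctranspose_scaleR ctranspose_mat)

lemma omega_pos:
  fixes lam bet :: "'m::finite \<Rightarrow> real"
  assumes "0 < \<rho>" "\<And>m. 0 < lam m" "\<And>m. 0 < bet m"
  shows "0 < omega \<rho> N lam bet"
  unfolding omega_def using assms
  by (intro positive_imp_inverse_positive add_nonneg_pos sum_nonneg divide_nonneg_nonneg)
    (auto simp: less_imp_le)

text \<open>The form is the sum of |L d_i|^2 over i \<noteq> m plus |L|^2 / \<omega>. The first part
  is nonnegative and the second is positive for \<open>L \<noteq> 0\<close>.\<close>

lemma Gmat_interference_pos:
  fixes L :: "complex^'n^1" and X :: "complex^'m^'n"
  assumes "0 < omega \<rho> N lam bet" "L \<noteq> 0"
  defines "d \<equiv> dvec \<rho> N lam bet X"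
  shows "0 < Re ((L ** (Gmat \<rho> N lam bet X - d m ** ctranspose (d m)) ** ctranspose L) $ 1 $ 1)"
proof -
  have G: "Gmat \<rho> N lam bet X - d m ** ctranspose (d m) =
      (\<Sum>i\<in>UNIV - {m}. d i ** ctranspose (d i)) + (1 / omega \<rho> N lam bet) *\<^sub>R mat 1"
    unfolding Gmat_eq d_def by (simp add: sum_diff1)
  have sc: "L ** (c *\<^sub>R mat 1) ** ctranspose L = c *\<^sub>R (L ** ctranspose L)" for c
  proof -
    have "L ** (c *\<^sub>R mat 1) = c *\<^sub>R (L ** mat 1)"
      by (simp only: matrix_matrix_mult_def vec_eq_iff scaleR_sum_right
          vec_lambda_beta vector_scaleR_component mult_scaleR_right simp_thms)
    moreover have "(c *\<^sub>R L) ** ctranspose L = c *\<^sub>R (L ** ctranspose L)"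
      by (simp add: matrix_matrix_mult_def vec_eq_iff scaleR_sum_right)
    ultimately show ?thesis by simp
  qed
  obtain k where k: "L $ 1 $ k \<noteq> 0"
    using \<open>L \<noteq> 0\<close> by (auto simp: vec_eq_iff)
  have "(L ** ctranspose L) $ 1 $ 1 = of_real (\<Sum>k\<in>UNIV. (cmod (L $ 1 $ k))\<^sup>2)"
    by (simp add: matrix_matrix_mult_def ctranspose_def complex_norm_square del: of_real_power)
  moreover have "0 < (\<Sum>k\<in>UNIV. (cmod (L $ 1 $ k))\<^sup>2)"
    using k by (intro sum_pos2[where i=k]) auto
  ultimately have "0 < Re ((L ** ctranspose L) $ 1 $ 1)" by simp
  then have "0 < Re ((L ** ((1 / omega \<rho> N lam bet) *\<^sub>R mat 1) ** ctranspose L) $ 1 $ 1)"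
    using assms(1) by (simp add: sc)
  moreover have "0 \<le> Re ((L ** (\<Sum>i\<in>UNIV - {m}. d i ** ctranspose (d i)) ** ctranspose L) $ 1 $ 1)"
    by (simp add: matrix_sum_sandwich rank_one_form matrix_mul_assoc sum_nonneg)
  ultimately show ?thesis
    unfolding G by (simp add: matrix_add_ldistrib matrix_add_rdistrib)
qed

text \<open>A kernel vector x yields L G L^H = 0 for the row L = x^H, which contradicts positive
  definiteness unless x = 0.\<close>

lemma invertible_Gmat:
  fixes X :: "complex^'m^'n"
  assumes "0 < omega \<rho> N lam bet"
  shows "invertible (Gmat \<rho> N lam bet X)"
  unfolding invertible_left_inverse matrix_left_invertible_ker
proof (intro allI impI)
  fix x assume x: "Gmat \<rho> N lam bet X *v x = 0"
  define L :: "complex^'n^1" where "L = ctranspose (columnvector x)"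
  have "Gmat \<rho> N lam bet X ** ctranspose L = 0"
    using x by (simp add: L_def columnvector_def matrix_matrix_mult_def matrix_vector_mult_def vec_eq_iff)
  then have 0: "(L ** Gmat \<rho> N lam bet X ** ctranspose L) $ 1 $ 1 = 0"
    by (simp flip: matrix_mul_assoc)
  have "L = 0"
  proof (rule ccontr)
    assume "L \<noteq> 0"
    \<comment> \<open>Any user index serves: L G L^H exceeds the interference form by the
      nonnegative |L d|^2, hence is itself positive.\<close>
    from Gmat_interference_pos[OF assms this, of X undefined] 0 show False
      by (simp add: matrix_diff_ldistrib matrix_diff_rdistrib rank_one_form matrix_mul_assoc)
  qed
  then have "(columnvector x :: complex^1^'n) = 0" by (simp add: L_def)
  then show "x = 0" by (simp add: columnvector_def vec_eq_iff)
qed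

lemma matrix_inv_left: "invertible A \<Longrightarrow> matrix_inv A ** A = mat 1"
  and matrix_inv_right: "invertible A \<Longrightarrow> A ** matrix_inv A = mat 1"
  unfolding invertible_def matrix_inv_def by (metis (mono_tags, lifting) someI_ex)+

lemma sinr_mmse_max:
  fixes L :: "complex^'n^1" and X :: "complex^'m^'n"
  assumes "0 < omega \<rho> N lam bet"
  shows "sinr (dvec \<rho> N lam bet X m) (Gmat \<rho> N lam bet X) L
    \<le> sinr (dvec \<rho> N lam bet X m) (Gmat \<rho> N lam bet X)
        (ctranspose (dvec \<rho> N lam bet X m) ** matrix_inv (Gmat \<rho> N lam bet X))"
proof (rule sinr_le)
  show "ctranspose (dvec \<rho> N lam bet X m) ** matrix_inv (Gmat \<rho> N lam bet X) ** Gmat \<rho> N lam bet X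
    = ctranspose (dvec \<rho> N lam bet X m)"
    by (simp add: matrix_inv_left[OF invertible_Gmat[OF assms]] flip: matrix_mul_assoc)
qed (rule ctranspose_Gmat, rule Gmat_interference_pos[OF assms])

section \<open>Borel measurability of matrix operations and of the SINR\<close>

lemma borel_measurable_vec_nth [measurable (raw)]:
  fixes f :: "'a \<Rightarrow> 'b::euclidean_space^'n"
  assumes "f \<in> borel_measurable M"
  shows "(\<lambda>x. f x $ i) \<in> borel_measurable M"
  by (rule borel_measurable_continuous_on[OF _ assms]) (intro continuous_intros)

lemma borel_measurable_vec:
  fixes f :: "'a \<Rightarrow> 'b::euclidean_space^'n"
  assumes "\<And>i. (\<lambda>x. f x $ i) \<in> borel_measurable M"
  shows "f \<in> borel_measurable M"
  unfolding borel_measurable_euclidean_space[of f]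
proof
  fix b :: "'b^'n" assume "b \<in> Basis"
  then obtain i u where b: "b = axis i u" by (auto simp: Basis_vec_def)
  have [measurable]: "(\<lambda>x. f x $ i) \<in> borel_measurable M" by fact
  show "(\<lambda>x. f x \<bullet> b) \<in> borel_measurable M"
    unfolding b inner_axis by measurable
qed

lemma borel_measurable_matrix:
  fixes f :: "'a \<Rightarrow> complex^'n^'m"
  assumes "\<And>i j. (\<lambda>x. f x $ i $ j) \<in> borel_measurable M"
  shows "f \<in> borel_measurable M"
  using assms by (intro borel_measurable_vec)

lemma borel_measurable_cnj [measurable (raw)]:
  assumes "f \<in> borel_measurable M"
  shows "(\<lambda>x. cnj (f x)) \<in> borel_measurable M"
  by (rule borel_measurable_continuous_on[OF _ assms]) (intro continuous_intros)

lemma borel_measurable_matrix_mul [measurable (raw)]: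
  fixes f :: "'a \<Rightarrow> complex^'n^'m" and g :: "'a \<Rightarrow> complex^'k^'n"
  assumes [measurable]: "f \<in> borel_measurable M" "g \<in> borel_measurable M"
  shows "(\<lambda>x. f x ** g x) \<in> borel_measurable M"
  by (rule borel_measurable_matrix) (simp add: matrix_matrix_mult_def)

lemma borel_measurable_ctranspose [measurable (raw)]:
  fixes f :: "'a \<Rightarrow> complex^'n^'m"
  assumes [measurable]: "f \<in> borel_measurable M"
  shows "(\<lambda>x. ctranspose (f x)) \<in> borel_measurable M"
  by (rule borel_measurable_matrix) (simp add: ctranspose_def)

lemma borel_measurable_det [measurable (raw)]:
  fixes f :: "'a \<Rightarrow> complex^'n^'n"
  assumes [measurable]: "f \<in> borel_measurable M"
  shows "(\<lambda>x. det (f x)) \<in> borel_measurable M"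
  unfolding det_def by measurable

text \<open>Column \<open>l\<close> of the inverse solves A x = e_l, and Cramer's rule applies. The
  explicit quotient of determinants gives access to measurability, which the choice in the
  definition of \<open>matrix_inv\<close> hides.\<close>

lemma matrix_inv_cramer:
  fixes A :: "'a::field^'n^'n"
  assumes "invertible A"
  shows "matrix_inv A $ k $ l =
    det (\<chi> i j. if j = k then mat 1 $ i $ l else A $ i $ j) / det A"
proof -
  have "A *v column l (matrix_inv A) = column l (A ** matrix_inv A)"
    by (simp add: column_def matrix_vector_mult_def matrix_matrix_mult_def)
  also have "\<dots> = column l (mat 1)"
    by (simp add: matrix_inv_right[OF assms])
  finally have "A *v column l (matrix_inv A) = column l (mat 1)" .
  then have "column l (matrix_inv A) =
      (\<chi> k. det (\<chi> i j. if j = k then column l (mat 1) $ i else A $ i $ j) / det A)"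
    using assms cramer invertible_det_nz by blast
  from arg_cong[OF this, of "\<lambda>v. v $ k"] show ?thesis
    by (simp add: column_def cong: if_cong)
qed

lemma borel_measurable_matrix_inv:
  fixes f :: "'a \<Rightarrow> complex^'n^'n"
  assumes [measurable]: "f \<in> borel_measurable M" and "\<And>x. invertible (f x)"
  shows "(\<lambda>x. matrix_inv (f x)) \<in> borel_measurable M"
proof (rule borel_measurable_matrix)
  fix k l
  have [measurable]: "(\<lambda>x. \<chi> i j. if j = k then mat 1 $ i $ l else f x $ i $ j) \<in> borel_measurable M"
    by (rule borel_measurable_matrix) simp
  show "(\<lambda>x. matrix_inv (f x) $ k $ l) \<in> borel_measurable M"
    unfolding matrix_inv_cramer[OF assms(2)] by measurable
qed

lemma borel_measurable_dvec [measurable (raw)]: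
  fixes f :: "'a \<Rightarrow> complex^'m^'n"
  assumes [measurable]: "f \<in> borel_measurable M"
  shows "(\<lambda>x. dvec \<rho> N lam bet (f x) m) \<in> borel_measurable M"
  by (rule borel_measurable_matrix) (simp add: dvec_def columnvector_def column_def)

lemma borel_measurable_Gmat [measurable (raw)]:
  fixes f :: "'a \<Rightarrow> complex^'m^'n"
  assumes [measurable]: "f \<in> borel_measurable M"
  shows "(\<lambda>x. Gmat \<rho> N lam bet (f x)) \<in> borel_measurable M"
proof -
  have [measurable]: "(\<lambda>x. Dmat \<rho> N lam bet (f x)) \<in> borel_measurable M"
    by (rule borel_measurable_matrix) (simp add: Dmat_def)
  show ?thesis unfolding Gmat_def by measurable
qed

lemma borel_measurable_sinr [measurable (raw)]:
  fixes d :: "'a \<Rightarrow> complex^1^'n"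
  assumes [measurable]: "d \<in> borel_measurable M" "G \<in> borel_measurable M" "L \<in> borel_measurable M"
  shows "(\<lambda>x. sinr (d x) (G x) (L x)) \<in> borel_measurable M"
  unfolding sinr_def by measurable

section \<open>Almost sure inequality of independent variables\<close>

text \<open>By independence the joint law is a product measure. For each fixed value x of
  \<open>X\<close> the event \<open>Y\<close> = x is null, so by Fubini the diagonal is null,
  whatever the law of \<open>X\<close>.\<close>

lemma (in prob_space) indep_var_AE_neq:
  fixes X Y :: "'a \<Rightarrow> 'b::euclidean_space"
  assumes ind: "indep_var borel X borel Y" and atomless: "\<And>y. AE w in M. Y w \<noteq> y"
  shows "AE w in M. X w \<noteq> Y w"
proof -
  have [measurable]: "X \<in> borel_measurable M" "Y \<in> borel_measurable M"
    using ind by (auto dest: indep_var_rv1 indep_var_rv2)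
  interpret X: prob_space "distr M borel X" by (rule prob_space_distr) simp
  interpret Y: prob_space "distr M borel Y" by (rule prob_space_distr) simp
  interpret XY: pair_sigma_finite "distr M borel X" "distr M borel Y" ..
  have "AE p in distr M borel X \<Otimes>\<^sub>M distr M borel Y. fst p \<noteq> snd p"
  proof (rule XY.AE_pair_measure)
    show "{p \<in> space (distr M borel X \<Otimes>\<^sub>M distr M borel Y). fst p \<noteq> snd p}
        \<in> sets (distr M borel X \<Otimes>\<^sub>M distr M borel Y)"
      by measurable
    have "AE y in distr M borel Y. x \<noteq> y" for x
      using atomless[of x] by (subst AE_distr_iff) (auto simp: eq_commute)
    then show "AE x in distr M borel X. AE y in distr M borel Y. fst (x, y) \<noteq> snd (x, y)"
      by simp
  qed
  then have "AE p in distr M (borel \<Otimes>\<^sub>M borel) (\<lambda>w. (X w, Y w)). fst p \<noteq> snd p"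
    using ind unfolding indep_var_distribution_eq by metis
  then show ?thesis by (subst (asm) AE_distr_iff) auto
qed

lemma (in prob_space) std_complex_normal_measurable:
  "std_complex_normal Z \<Longrightarrow> Z \<in> borel_measurable M"
  using distributed_measurable[of M lborel Z] by (auto simp: std_complex_normal_def)

text \<open>The law has a density with respect to Lebesgue measure, for which singletons are
  null.\<close>

lemma (in prob_space) std_complex_normal_AE_neq:
  assumes "std_complex_normal Z"
  shows "AE w in M. Z w \<noteq> z"
proof -
  have D: "distributed M lborel Z (\<lambda>z. ennreal (exp (- (cmod z)\<^sup>2) / pi))"
    using assms by (simp add: std_complex_normal_def)
  have [measurable]: "Z \<in> borel_measurable M" using assms by (rule std_complex_normal_measurable)
  have "AE x in lborel. x \<noteq> z" by (rule AE_lborel_singleton)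
  then have "AE x in density lborel (\<lambda>z. ennreal (exp (- (cmod z)\<^sup>2) / pi)). x \<noteq> z"
    by (subst AE_density) (auto elim: eventually_mono)
  then have "AE x in distr M lborel Z. x \<noteq> z"
    unfolding distributed_distr_eq_density[OF D] .
  then show ?thesis by (subst (asm) AE_distr_iff) auto
qed

section \<open>Admissibility of the optimal detector\<close>

lemma borel_measurable_mmse_detector:
  fixes f :: "'a \<Rightarrow> complex^'m^'n"
  assumes "0 < omega \<rho> N lam bet" and [measurable]: "f \<in> borel_measurable M"
  shows "(\<lambda>x. ctranspose (dvec \<rho> N lam bet (f x) m) ** matrix_inv (Gmat \<rho> N lam bet (f x)))
    \<in> borel_measurable M"
proof -
  have [measurable]: "(\<lambda>x. matrix_inv (Gmat \<rho> N lam bet (f x))) \<in> borel_measurable M"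
    by (intro borel_measurable_matrix_inv invertible_Gmat assms borel_measurable_Gmat)
  show ?thesis by measurable
qed

text \<open>Multiplying by \<open>Gmat\<close> on the right cancels the inverse, so a vanishing
  detector means a vanishing estimate.\<close>

lemma mmse_detector_eq_0_iff:
  fixes X :: "complex^'m^'n"
  assumes "0 < omega \<rho> N lam bet"
  shows "ctranspose (dvec \<rho> N lam bet X m) ** matrix_inv (Gmat \<rho> N lam bet X) = 0
    \<longleftrightarrow> dvec \<rho> N lam bet X m = 0"
proof
  assume "ctranspose (dvec \<rho> N lam bet X m) ** matrix_inv (Gmat \<rho> N lam bet X) = 0"
  then have "ctranspose (dvec \<rho> N lam bet X m) ** (matrix_inv (Gmat \<rho> N lam bet X) ** Gmat \<rho> N lam bet X) = 0"
    by (simp add: matrix_mul_assoc)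
  then show "dvec \<rho> N lam bet X m = 0"
    by (simp add: matrix_inv_left[OF invertible_Gmat[OF assms]])
next
  assume "dvec \<rho> N lam bet X m = 0"
  then have "ctranspose (dvec \<rho> N lam bet X m) = 0" by simp
  then show "ctranspose (dvec \<rho> N lam bet X m) ** matrix_inv (Gmat \<rho> N lam bet X) = 0"
    by (simp only: times0_left)
qed

section \<open>Joint optimality over all users\<close>

theorem theorem6:
  fixes P :: "'w measure"
    and \<rho> :: real and lam bet r :: "'m::finite \<Rightarrow> real"
    and N_CU N_LoP R_CU :: nat
    and s :: "'m \<Rightarrow> complex^1^'p::finite"
    and h :: "'m \<Rightarrow> 'w \<Rightarrow> complex^1^'n::finite"
    and Np :: "'w \<Rightarrow> complex^'p^'n"
    and H :: "'w \<Rightarrow> complex^'m^'n"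
  assumes "prob_space P"
    and "CARD('m) < CARD('n)"
    and "\<rho> > 0" and "\<And>m. lam m > 0" and "\<And>m. bet m > 0" and "\<And>m. r m \<ge> 0"
    and "CARD('p) = N_LoP" and "N_CU = N_LoP + R_CU" and "N_LoP \<in> {CARD('m)..N_CU - 1}"
    and "\<And>m. ctranspose (s m) ** s m = mat 1"
    and "\<And>m n. m \<noteq> n \<Longrightarrow> ctranspose (s m) ** s n = 0"
    and "\<And>m k. prob_space.std_complex_normal P (\<lambda>w. h m w $ k $ 1)"
    and "\<And>k j. prob_space.std_complex_normal P (\<lambda>w. Np w $ k $ j)"
    and "\<And>m. prob_space.indep_vars P (\<lambda>_. borel)
           (case_sum (\<lambda>k w. h m w $ k $ 1) (\<lambda>(k, j) w. Np w $ k $ j)) UNIV"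
    and "\<And>m w. w \<in> space P \<Longrightarrow> columnvector (column m (H w)) - h m w =
           (1 / (real N_LoP * sqrt (\<rho> * lam m * bet m))) *\<^sub>R
             (Np w ** ctranspose (transpose (s m)))"
  shows "is_arg_min
           (\<lambda>L. \<Sum>m\<in>UNIV. expected_err P R_CU (r m) (sinr_rv \<rho> N_LoP lam bet H m (L m)))
           (linear_detectors P H)
           (\<lambda>m X. ctranspose (dvec \<rho> N_LoP lam bet X m)
                    ** matrix_inv (Gmat \<rho> N_LoP lam bet X))"
proof -
  interpret prob_space P by fact
  define opt where "opt m X = ctranspose (dvec \<rho> N_LoP lam bet X m) ** matrix_inv (Gmat \<rho> N_LoP lam bet X)"
    for m and X :: "complex^'m^'n"
  have om: "0 < omega \<rho> N_LoP lam bet" by (intro omega_pos assms)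
  define c where "c m = 1 / (real N_LoP * sqrt (\<rho> * lam m * bet m))" for m
  \<comment> \<open>The estimation error in entry (k, m), written as a function of the whole family
    of Gaussian entries: \<open>Inl\<close> indexes the channel and \<open>Inr\<close> the pilot
    noise. It reads only \<open>Inr\<close> coordinates, which independence exploits below.\<close>
  define E where "E m k v = c m *\<^sub>R (\<Sum>j\<in>UNIV. v (Inr (k, j)) * cnj (s m $ j $ 1))"
    for m and k :: 'n and v :: "'n + 'n \<times> 'p \<Rightarrow> complex"
  define V where "V m w = case_sum (\<lambda>k. h m w $ k $ 1) (\<lambda>(k, j). Np w $ k $ j)" for m w
  have V: "(\<lambda>i w. V m w i) = case_sum (\<lambda>k w. h m w $ k $ 1) (\<lambda>(k, j) w. Np w $ k $ j)" for m
    by (auto simp: V_def fun_eq_iff split: sum.split)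
  have H_eq: "H w $ k $ m = h m w $ k $ 1 + E m k (V m w)" if "w \<in> space P" for w k m
  proof -
    have "columnvector (column m (H w)) = h m w + c m *\<^sub>R (Np w ** ctranspose (transpose (s m)))"
      using assms(15)[OF that, of m, folded c_def] by (simp add: diff_eq_eq)
    then have "(columnvector (column m (H w)) :: complex^1^'n) $ k $ 1 = h m w $ k $ 1 +
        (c m *\<^sub>R (Np w ** ctranspose (transpose (s m)))) $ k $ 1"
      by simp
    then show ?thesis
      by (simp add: columnvector_def column_def E_def V_def matrix_matrix_mult_def
          ctranspose_def transpose_def)
  qed
  have meas_h [measurable]: "(\<lambda>w. h m w $ k $ 1) \<in> borel_measurable P" for m k
    by (rule std_complex_normal_measurable[OF assms(12)])
  have meas_N [measurable]: "(\<lambda>w. Np w $ k $ j) \<in> borel_measurable P" for k j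
    by (rule std_complex_normal_measurable[OF assms(13)])
  \<comment> \<open>On the sample space each entry of \<open>H\<close> agrees with a finite
    combination of measurable Gaussian entries.\<close>
  have meas_H [measurable]: "H \<in> borel_measurable P"
  proof (rule borel_measurable_matrix)
    fix k m
    have "(\<lambda>w. h m w $ k $ 1 + E m k (V m w)) \<in> borel_measurable P"
      by (simp add: E_def V_def)
    then show "(\<lambda>w. H w $ k $ m) \<in> borel_measurable P"
      by (subst measurable_cong[OF H_eq])
  qed
  have H_nz: "AE w in P. H w $ k $ m \<noteq> 0" for k m
  proof -
    have "indep_vars (\<lambda>_. borel) (\<lambda>i w. V m w i) UNIV"
      unfolding V by (rule assms)
    \<comment> \<open>The index sets of the noise entries and of the single channel entry are
      disjoint, so the restricted families are independent. A zero of the estimate would require the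
      channel entry to equal minus the error.\<close>
    then have "indep_var (PiM (range Inr) (\<lambda>_. borel)) (\<lambda>w. \<lambda>i\<in>range Inr. V m w i)
        (PiM {Inl k} (\<lambda>_. borel)) (\<lambda>w. \<lambda>i\<in>{Inl k}. V m w i)"
      by (rule indep_var_restrict) auto
    moreover have "(\<lambda>v. - E m k v) \<in> borel_measurable (PiM (range Inr) (\<lambda>_. borel))"
      unfolding E_def by measurable
    moreover have "(\<lambda>v. v (Inl k)) \<in> borel_measurable (PiM {Inl k :: 'n + 'n \<times> 'p} (\<lambda>_. borel :: complex measure))"
      by measurable
    ultimately have "indep_var borel ((\<lambda>v. - E m k v) \<circ> (\<lambda>w. \<lambda>i\<in>range Inr. V m w i))
        borel ((\<lambda>v. v (Inl k)) \<circ> (\<lambda>w. \<lambda>i\<in>{Inl k}. V m w i))"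
      by (rule indep_var_compose)
    then have "indep_var borel (\<lambda>w. - E m k (V m w)) borel (\<lambda>w. h m w $ k $ 1)"
      by (simp add: comp_def E_def V_def)
    then have "AE w in P. - E m k (V m w) \<noteq> h m w $ k $ 1"
      by (rule indep_var_AE_neq) (rule std_complex_normal_AE_neq[OF assms(12)])
    with AE_space show ?thesis
      by eventually_elim (auto simp: H_eq add_eq_0_iff2)
  qed
  \<comment> \<open>The pilot length is the cardinality of a finite, nonempty index type. Its
    positivity keeps \<open>delta\<close> away from 0.\<close>
  have "0 < N_LoP" using assms(7) zero_less_card_finite[where 'a='p] by simp
  have opt_nz: "AE w in P. opt m (H w) \<noteq> 0" for m
  proof -
    \<comment> \<open>One nonvanishing entry of the estimate suffices, so any antenna index may be
      taken.\<close>
    fix k :: 'n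
    have "delta \<rho> N_LoP lam bet m * sqrt (lam m * bet m) \<noteq> 0"
      using assms(3) assms(4,5)[of m] \<open>0 < N_LoP\<close>
      by (simp add: delta_def add_nonneg_eq_0_iff)
    then have "dvec \<rho> N_LoP lam bet (H w) m \<noteq> 0" if "H w $ k $ m \<noteq> 0" for w
      using that by (auto simp: dvec_def columnvector_def column_def vec_eq_iff)
    then show ?thesis
      using H_nz[of k m] by (auto simp: opt_def mmse_detector_eq_0_iff[OF om])
  qed
  have opt_meas: "opt m \<in> borel_measurable borel" for m
    using borel_measurable_mmse_detector[OF om, of "\<lambda>X. X" borel m] by (simp add: opt_def[abs_def])
  have sinr_meas: "sinr_rv \<rho> N_LoP lam bet H m L \<in> borel_measurable P"
    if [measurable]: "L \<in> borel_measurable borel" for m L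
    unfolding sinr_rv_def by measurable
  have "linear_detectors P H opt"
    using opt_nz opt_meas by (simp add: linear_detectors_def)
  moreover have "(\<Sum>m\<in>UNIV. expected_err P R_CU (r m) (sinr_rv \<rho> N_LoP lam bet H m (opt m)))
      \<le> (\<Sum>m\<in>UNIV. expected_err P R_CU (r m) (sinr_rv \<rho> N_LoP lam bet H m (L m)))"
    if "linear_detectors P H L" for L
  \<comment> \<open>The summand of user \<open>m\<close> depends on \<open>L m\<close> only, so the
    sum is compared term by term and each term reduces to the pointwise SINR inequality.\<close>
  proof (intro sum_mono expected_err_antimono assms(6))
    fix m w
    show "sinr_rv \<rho> N_LoP lam bet H m (L m) \<in> borel_measurable P"
      using that by (intro sinr_meas) (simp add: linear_detectors_def)
    show "sinr_rv \<rho> N_LoP lam bet H m (opt m) \<in> borel_measurable P"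
      by (intro sinr_meas opt_meas)
    show "0 \<le> sinr_rv \<rho> N_LoP lam bet H m (L m) w"
      unfolding sinr_rv_def by (intro sinr_nonneg Gmat_interference_pos[OF om])
    show "sinr_rv \<rho> N_LoP lam bet H m (L m) w \<le> sinr_rv \<rho> N_LoP lam bet H m (opt m) w"
      unfolding sinr_rv_def opt_def by (rule sinr_mmse_max[OF om])
  qed
  ultimately have "is_arg_min
      (\<lambda>L. \<Sum>m\<in>UNIV. expected_err P R_CU (r m) (sinr_rv \<rho> N_LoP lam bet H m (L m)))
      (linear_detectors P H) opt"
    by (auto simp: is_arg_min_def not_less)
  then show ?thesis by (simp add: opt_def[abs_def])
qed

end
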